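(* Let $a=(u=s_0,s_1,\ldots,s_k,s_{k+1}=v)$, $k\ge 1$, be a station sequence between $u$ and $v$, and let $x\in[0,M]\cup\{-\infty\}$ be the charge level at the end of $u$. Consider the schedule $\mathbf t^{*}(x)=(t^{\mathrm b,*}_1,t^{\mathrm e,*}_1,\ldots,t^{\mathrm b,*}_k,t^{\mathrm e,*}_k)$ defined recursively, with $t^{\mathrm e,*}_0=t^{\mathrm e}_u$, by $$t^{\mathrm b,*}_i = t^{\mathrm e,*}_{i-1}+\delta_{s_{i-1},s_i}\quad (1\le i\le k),$$ $$t^{\mathrm e,*}_i=\begin{cases} t^{\mathrm b,*}_i & \text{if } 1\le i\le k-1 \text{ and } \ell^{\mathrm b}_i(x,\mathbf t^*(x))\ge e_{s_i,s_{i+1}},\\ t^{\mathrm b,*}_i+t^{\mathrm{ch}}\big(\ell^{\mathrm b}_i(x,\mathbf t^*(x)),\,e_{s_i,s_{i+1}}\big) & \text{if } 1\le i\le k-1 \text{ and } \ell^{\mathrm b}_i(x,\mathbf t^*(x))< e_{s_i,s_{i+1}},\\ t^{\mathrm b}_v-\delta_{s_k,v} & \text{if } i=k.\end{cases}$$ If $\mathbf t^*(x)$ is feasible, i.e. $t^{\mathrm b,*}_k\le t^{\mathrm e,*}_k$, then it is an optimal solution of the problem $$\overrightarrow f_a(x)=\max\{\ell^{\mathrm e}_{k+1}(x,\mathbf t)\colon \mathbf t \text{ a feasible schedule of } a\}.$$ Otherwise, $\overrightarrow f_a(x)=-\infty$.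
   Context: Charging. $M>0$ is the battery capacity. $\varphi:[0,M]\times[0,\infty)\to[0,M]$ is the flow of an ODE $\frac{d\ell}{dt}=i(\ell)$ with $i$ non-increasing and non-negative; $\varphi(\ell,\tau)$ is the level after charging for a duration $\tau$ from level $\ell$. It satisfies: $\varphi(\ell,0)=\ell$; $\varphi$ is non-decreasing in each variable; $\tau\mapsto\varphi(\ell,\tau)$ is concave; $\ell\mapsto\varphi(\ell,\tau)-\ell$ is non-increasing; $\varphi(\ell,\tau+\tau')=\varphi(\varphi(\ell,\tau),\tau')$. For $\ell\le\ell'$ in $[0,M]$, $t^{\mathrm{ch}}(\ell,\ell')=\min\{\tau\ge0:\varphi(\ell,\tau)=\ell'\}$ (the set is assumed nonempty), and $t^{\mathrm{ch}}(\ell,\ell')=-t^{\mathrm{ch}}(\ell',\ell)$ if $\ell>\ell'$. Conventions: $\varphi(-\infty,\tau)=-\infty$ and $t^{\mathrm{ch}}(-\infty,\ell')=0$. Station sequences. There are sets $\mathcal T$ (services), $\mathcal D$ (depots), $\mathcal S$ (charging stations), and a horizon $[0,t_{\max}]$. Each service $w$ has a fixed begin time $t^{\mathrm b}_w$ and end time $t^{\mathrm e}_w$; for a depot $w$, $t^{\mathrm b}_w=t_{\max}$ and $t^{\mathrm e}_w=0$. $\delta_{w,w'}\ge 0$ and $e_{w,w'}\ge0$ are the travel time and energy needed to go from $w$ to $w'$; $e_w\ge0$ is the energy consumed by service $w$, with $e_w=0$ for depots and stations. For $u,v\in\mathcal D\cup\mathcal T$, a station sequence between $u$ and $v$ is a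 sequence $u=s_0,s_1,\ldots,s_k,s_{k+1}=v$ with $s_1,\ldots,s_k\in\mathcal S$ such that $t^{\mathrm e}_u+\sum_{i=1}^{k+1}\delta_{s_{i-1},s_i}\le t^{\mathrm b}_v$, $e_u+e_{u,s_1}\le M$, $e_{s_{i-1},s_i}\le M$ for $1\le i\le k$, and $e_{s_k,v}+e_v\le M$. Schedules and levels. A schedule is a vector $\mathbf t=(t^{\mathrm b}_1,t^{\mathrm e}_1,\ldots,t^{\mathrm b}_k,t^{\mathrm e}_k)$ of arrival and departure times at $s_1,\ldots,s_k$. With $t^{\mathrm e}_0=t^{\mathrm e}_u$ and $t^{\mathrm b}_{k+1}=t^{\mathrm b}_v$, it is feasible if $t^{\mathrm b}_i=t^{\mathrm e}_{i-1}+\delta_{s_{i-1},s_i}$ for $1\le i\le k+1$ and $t^{\mathrm b}_i\le t^{\mathrm e}_i$ for $1\le i\le k$. Let $\mathrm{pos}(z)=z$ if $z\ge0$ and $-\infty$ otherwise. The levels at the beginning ($\mathrm b$) and end ($\mathrm e$) of each element are: $\ell^{\mathrm e}_0(x,\mathbf t)=x$; $\ell^{\mathrm b}_i(x,\mathbf t)=\mathrm{pos}(\ell^{\mathrm e}_{i-1}(x,\mathbf t)-e_{s_{i-1},s_i})$ for $1\le i\le k+1$; for $1\le i\le k$, $\ell^{\mathrm e}_i(x,\mathbf t)=\varphi(\ell^{\mathrm b}_i(x,\mathbf t),t^{\mathrm e}_i-t^{\mathrm b}_i)$ if $t^{\mathrm e}_i\ge t^{\mathrm b}_i$ and $-\infty$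 otherwise; $\ell^{\mathrm e}_{k+1}(x,\mathbf t)=\mathrm{pos}(\ell^{\mathrm b}_{k+1}(x,\mathbf t)-e_v)$. *)

theory Defs
  imports "HOL-Analysis.Analysis"
begin

text \<open>Locations (services, depots and charging stations) are elements of one type; the travel
  data and the energy consumptions are functions on it, constrained on the locations only.\<close>

record 'w charging_data =
  capacity :: real
  rate :: "real \<Rightarrow> real"
  flow :: "real \<Rightarrow> real \<Rightarrow> real"
  services :: "'w set"
  depots :: "'w set"
  stations :: "'w set"
  horizon :: real
  begin_time :: "'w \<Rightarrow> real"
  end_time :: "'w \<Rightarrow> real"
  travel_time :: "'w \<Rightarrow> 'w \<Rightarrow> real"
  travel_energy :: "'w \<Rightarrow> 'w \<Rightarrow> real"
  energy :: "'w \<Rightarrow> real"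

definition locations :: "'w charging_data \<Rightarrow> 'w set" where
  "locations I = services I \<union> depots I \<union> stations I"

text \<open>The charging rate is monotone but may jump (for example, for piecewise linear charging
  curves). The differential equation is therefore required outside a countable set of times
  only, together with continuity; a solution that is differentiable everywhere is the special
  case of an empty exceptional set. The assumption \<open>reachable\<close> is what makes the minimum in the
  definition of the charging time meaningful.\<close>

locale charging_instance =
  fixes I :: "'w charging_data"
  assumes capacity_pos: "0 < capacity I"
    and rate_nonneg: "\<And>l. l \<in> {0..capacity I} \<Longrightarrow> 0 \<le> rate I l"
    and rate_antimono: "antimono_on {0..capacity I} (rate I)"
    and flow_range: "\<And>l \<tau>. l \<in> {0..capacity I} \<Longrightarrow> 0 \<le> \<tau> \<Longrightarrow> flow I l \<tau> \<in> {0..capacity I}"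
    and flow_continuous: "\<And>l. l \<in> {0..capacity I} \<Longrightarrow> continuous_on {0..} (flow I l)"
    and flow_ode: "\<And>l. l \<in> {0..capacity I} \<Longrightarrow>
      \<exists>N. countable N \<and> (\<forall>\<tau>\<in>{0..} - N.
        (flow I l has_real_derivative rate I (flow I l \<tau>)) (at \<tau> within {0..}))"
    and flow_0: "\<And>l. l \<in> {0..capacity I} \<Longrightarrow> flow I l 0 = l"
    and flow_mono_level: "\<And>\<tau>. 0 \<le> \<tau> \<Longrightarrow> mono_on {0..capacity I} (\<lambda>l. flow I l \<tau>)"
    and flow_mono_time: "\<And>l. l \<in> {0..capacity I} \<Longrightarrow> mono_on {0..} (flow I l)"
    and flow_concave: "\<And>l. l \<in> {0..capacity I} \<Longrightarrow> concave_on {0..} (flow I l)"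
    and flow_gain_antimono: "\<And>\<tau>. 0 \<le> \<tau> \<Longrightarrow> antimono_on {0..capacity I} (\<lambda>l. flow I l \<tau> - l)"
    and flow_add: "\<And>l \<tau> \<tau>'. l \<in> {0..capacity I} \<Longrightarrow> 0 \<le> \<tau> \<Longrightarrow> 0 \<le> \<tau>' \<Longrightarrow>
      flow I l (\<tau> + \<tau>') = flow I (flow I l \<tau>) \<tau>'"
    and reachable: "\<And>l l'. 0 \<le> l \<Longrightarrow> l \<le> l' \<Longrightarrow> l' \<le> capacity I \<Longrightarrow> \<exists>\<tau>\<ge>0. flow I l \<tau> = l'"
    and horizon_nonneg: "0 \<le> horizon I"
    and depot_times: "\<And>w. w \<in> depots I \<Longrightarrow> begin_time I w = horizon I \<and> end_time I w = 0"
    and travel_time_nonneg: "\<And>w w'. w \<in> locations I \<Longrightarrow> w' \<in> locations I \<Longrightarrow> 0 \<le> travel_time I w w'"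
    and travel_energy_nonneg: "\<And>w w'. w \<in> locations I \<Longrightarrow> w' \<in> locations I \<Longrightarrow> 0 \<le> travel_energy I w w'"
    and energy_nonneg: "\<And>w. w \<in> services I \<Longrightarrow> 0 \<le> energy I w"
    and energy_0: "\<And>w. w \<in> depots I \<union> stations I \<Longrightarrow> energy I w = 0"

text \<open>Levels are extended reals, the value \<open>-\<infinity>\<close> marking a violated constraint.\<close>

definition ext_flow :: "'w charging_data \<Rightarrow> ereal \<Rightarrow> real \<Rightarrow> ereal" where
  "ext_flow I l \<tau> = (if l = -\<infinity> then -\<infinity> else ereal (flow I (real_of_ereal l) \<tau>))"

definition min_charge_time :: "'w charging_data \<Rightarrow> real \<Rightarrow> real \<Rightarrow> real" where
  "min_charge_time I l l' = (LEAST \<tau>. 0 \<le> \<tau> \<and> flow I l \<tau> = l')"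

definition charge_time :: "'w charging_data \<Rightarrow> ereal \<Rightarrow> real \<Rightarrow> real" where
  "charge_time I l l' =
    (if l = -\<infinity> then 0
     else if l \<le> ereal l' then min_charge_time I (real_of_ereal l) l'
     else - min_charge_time I l' (real_of_ereal l))"

definition pos :: "ereal \<Rightarrow> ereal" where
  "pos z = (if 0 \<le> z then z else -\<infinity>)"

text \<open>A sequence \<open>s\<^sub>0, \<dots>, s\<^bsub>k+1\<^esub>\<close> is given by \<open>k\<close> and a function \<open>s\<close>; values of \<open>s\<close>
  beyond \<open>k + 1\<close> are irrelevant.\<close>

definition station_sequence ::
  "'w charging_data \<Rightarrow> 'w \<Rightarrow> 'w \<Rightarrow> nat \<Rightarrow> (nat \<Rightarrow> 'w) \<Rightarrow> bool" where
  "station_sequence I u v k s \<longleftrightarrow>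
    u \<in> depots I \<union> services I \<and> v \<in> depots I \<union> services I \<and>
    s 0 = u \<and> s (k + 1) = v \<and> (\<forall>i\<in>{1..k}. s i \<in> stations I) \<and>
    end_time I u + (\<Sum>i=1..k+1. travel_time I (s (i - 1)) (s i)) \<le> begin_time I v \<and>
    energy I u + travel_energy I u (s 1) \<le> capacity I \<and>
    (\<forall>i\<in>{1..k}. travel_energy I (s (i - 1)) (s i) \<le> capacity I) \<and>
    travel_energy I (s k) v + energy I v \<le> capacity I"

text \<open>A schedule maps \<open>i \<in> {1..k}\<close> to the pair of the arrival and the departure time at \<open>s\<^sub>i\<close>;
  its other values are never used. The functions \<open>arrive\<close> and \<open>depart\<close> add the fixed times at
  the two ends of the sequence.\<close>

type_synonym schedule = "nat \<Rightarrow> real \<times> real"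

definition arrive :: "'w charging_data \<Rightarrow> nat \<Rightarrow> (nat \<Rightarrow> 'w) \<Rightarrow> schedule \<Rightarrow> nat \<Rightarrow> real" where
  "arrive I k s t i = (if i = k + 1 then begin_time I (s (k + 1)) else fst (t i))"

definition depart :: "'w charging_data \<Rightarrow> (nat \<Rightarrow> 'w) \<Rightarrow> schedule \<Rightarrow> nat \<Rightarrow> real" where
  "depart I s t i = (if i = 0 then end_time I (s 0) else snd (t i))"

definition feasible_schedule ::
  "'w charging_data \<Rightarrow> nat \<Rightarrow> (nat \<Rightarrow> 'w) \<Rightarrow> schedule \<Rightarrow> bool" where
  "feasible_schedule I k s t \<longleftrightarrow>
    (\<forall>i\<in>{1..k+1}. arrive I k s t i = depart I s t (i - 1) + travel_time I (s (i - 1)) (s i)) \<and>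
    (\<forall>i\<in>{1..k}. arrive I k s t i \<le> depart I s t i)"

text \<open>The level at the beginning is only meant for indices at least 1, the value at 0 being a
  dummy; indices above \<open>k + 1\<close> are never used.\<close>

function level_begin ::
    "'w charging_data \<Rightarrow> nat \<Rightarrow> (nat \<Rightarrow> 'w) \<Rightarrow> ereal \<Rightarrow> schedule \<Rightarrow> nat \<Rightarrow> ereal"
  and level_end ::
    "'w charging_data \<Rightarrow> nat \<Rightarrow> (nat \<Rightarrow> 'w) \<Rightarrow> ereal \<Rightarrow> schedule \<Rightarrow> nat \<Rightarrow> ereal" where
  "level_begin I k s x t 0 = x"
| "level_begin I k s x t (Suc i) =
    pos (level_end I k s x t i - ereal (travel_energy I (s i) (s (Suc i))))"
| "level_end I k s x t 0 = x"
| "level_end I k s x t (Suc i) =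
    (if Suc i \<le> k then
       if arrive I k s t (Suc i) \<le> depart I s t (Suc i)
       then ext_flow I (level_begin I k s x t (Suc i))
              (depart I s t (Suc i) - arrive I k s t (Suc i))
       else -\<infinity>
     else pos (level_begin I k s x t (Suc i) - ereal (energy I (s (Suc i)))))"
  by pat_completeness auto
termination
  by (relation "Wellfounded.measure (case_sum (\<lambda>(I, k, s, x, t, i). 2 * i) (\<lambda>(I, k, s, x, t, i). 2 * i + 1))")
    auto

definition final_level ::
  "'w charging_data \<Rightarrow> nat \<Rightarrow> (nat \<Rightarrow> 'w) \<Rightarrow> ereal \<Rightarrow> schedule \<Rightarrow> ereal" where
  "final_level I k s x t = level_end I k s x t (k + 1)"

definition best_level :: "'w charging_data \<Rightarrow> nat \<Rightarrow> (nat \<Rightarrow> 'w) \<Rightarrow> ereal \<Rightarrow> ereal" where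
  "best_level I k s x = (GREATEST y. \<exists>t. feasible_schedule I k s t \<and> y = final_level I k s x t)"

definition optimal_schedule ::
  "'w charging_data \<Rightarrow> nat \<Rightarrow> (nat \<Rightarrow> 'w) \<Rightarrow> ereal \<Rightarrow> schedule \<Rightarrow> bool" where
  "optimal_schedule I k s x t \<longleftrightarrow> is_arg_max (final_level I k s x) (feasible_schedule I k s) t"

text \<open>The times at \<open>s\<^bsub>i+1\<^esub>\<close> are computed from the schedule built for \<open>s\<^sub>1, \<dots>, s\<^sub>i\<close>, which
  already determines the level on arrival at \<open>s\<^bsub>i+1\<^esub>\<close>. The lemmas \<open>arrive_lazy_schedule\<close> and
  \<open>depart_lazy_schedule\<close> below give the resulting recursion in terms of the complete schedule.\<close>

primrec lazy_upto ::
  "'w charging_data \<Rightarrow> nat \<Rightarrow> (nat \<Rightarrow> 'w) \<Rightarrow> ereal \<Rightarrow> nat \<Rightarrow> schedule" where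
  "lazy_upto I k s x 0 = (\<lambda>_. (0, 0))"
| "lazy_upto I k s x (Suc i) =
    (let t = lazy_upto I k s x i;
         l = level_begin I k s x t (Suc i);
         e = travel_energy I (s (Suc i)) (s (Suc i + 1));
         a = depart I s t i + travel_time I (s i) (s (Suc i));
         d = (if Suc i = k then begin_time I (s (k + 1)) - travel_time I (s k) (s (k + 1))
              else if ereal e \<le> l then a
              else a + charge_time I l e)
     in t(Suc i := (a, d)))"

definition lazy_schedule ::
  "'w charging_data \<Rightarrow> nat \<Rightarrow> (nat \<Rightarrow> 'w) \<Rightarrow> ereal \<Rightarrow> schedule" where
  "lazy_schedule I k s x = lazy_upto I k s x k"

lemma lazy_upto_stable: "j \<le> i \<Longrightarrow> i \<le> n \<Longrightarrow> lazy_upto I k s x n j = lazy_upto I k s x i j"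
  by (induction n) (auto simp: Let_def le_Suc_eq)

lemma level_cong:
  shows "(\<And>j. 1 \<le> j \<Longrightarrow> j < i \<Longrightarrow> t j = t' j) \<Longrightarrow> level_begin I k s x t i = level_begin I k s x t' i"
    and "(\<And>j. 1 \<le> j \<Longrightarrow> j \<le> i \<Longrightarrow> t j = t' j) \<Longrightarrow> level_end I k s x t i = level_end I k s x t' i"
proof (induction i)
  case (Suc i)
  {
    case 1
    then show ?case using Suc(2) by simp
  next
    case 2
    have "level_begin I k s x t (Suc i) = level_begin I k s x t' (Suc i)"
      using Suc(2) 2 by simp
    moreover have "t (Suc i) = t' (Suc i)" using 2 by simp
    ultimately show ?case by (simp add: arrive_def depart_def del: level_begin.simps)
  }
qed simp_all

lemma lazy_upto_Suc:
  assumes "Suc i \<le> k"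
  shows "lazy_schedule I k s x (Suc i) = lazy_upto I k s x (Suc i) (Suc i)"
    and "depart I s (lazy_schedule I k s x) i = depart I s (lazy_upto I k s x i) i"
    and "level_begin I k s x (lazy_schedule I k s x) (Suc i) =
      level_begin I k s x (lazy_upto I k s x i) (Suc i)"
proof -
  have *: "lazy_schedule I k s x j = lazy_upto I k s x i' j" if "j \<le> i'" "i' \<le> k" for j i'
    using that unfolding lazy_schedule_def by (rule lazy_upto_stable)
  show "lazy_schedule I k s x (Suc i) = lazy_upto I k s x (Suc i) (Suc i)"
    using assms by (intro *) auto
  show "depart I s (lazy_schedule I k s x) i = depart I s (lazy_upto I k s x i) i"
    using assms *[of i i] by (simp add: depart_def)
  show "level_begin I k s x (lazy_schedule I k s x) (Suc i) =
      level_begin I k s x (lazy_upto I k s x i) (Suc i)"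
    using assms by (intro level_cong(1) *) auto
qed

lemma arrive_lazy_schedule:
  assumes "i \<in> {1..k}"
  shows "arrive I k s (lazy_schedule I k s x) i =
    depart I s (lazy_schedule I k s x) (i - 1) + travel_time I (s (i - 1)) (s i)"
proof -
  obtain j where "i = Suc j" "Suc j \<le> k" using assms by (cases i) auto
  then show ?thesis
    using lazy_upto_Suc[of j k I s x] by (simp add: arrive_def Let_def)
qed

lemma depart_lazy_schedule:
  fixes I k s x
  defines "t \<equiv> lazy_schedule I k s x"
  assumes "i \<in> {1..k}"
  shows "depart I s t i =
    (if i = k then begin_time I (s (k + 1)) - travel_time I (s k) (s (k + 1))
     else if ereal (travel_energy I (s i) (s (i + 1))) \<le> level_begin I k s x t i
     then arrive I k s t i
     else arrive I k s t i +
       charge_time I (level_begin I k s x t i) (travel_energy I (s i) (s (i + 1))))"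
proof -
  obtain j where j: "i = Suc j" "Suc j \<le> k" using assms(2) by (cases i) auto
  have "depart I s t i = snd (t i)" "arrive I k s t i = fst (t i)"
    using j by (simp_all add: depart_def arrive_def)
  then show ?thesis
    using j lazy_upto_Suc[of j k I s x] unfolding t_def
    by (simp add: Let_def del: level_begin.simps)
qed

end

theory Submission
  imports Defs
begin

text \<open>The lazy schedule dominates every feasible schedule \<open>t\<close> that does not run empty: it
  reaches each station no later than \<open>t\<close>, and if it spent its lead there charging, it would
  have at least the level of \<open>t\<close>. The lead never becomes negative, because the lazy schedule
  charges only the minimal amount without which the next station is out of reach. The level
  comparison survives the consumption of energy on the way to the next station, because
  charging is faster at lower levels. At the last station both schedules leave at the same
  time, so the lead is turned into charge.\<close>

section \<open>Truncation and admissible levels\<close>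

lemma pos_eq_ereal_iff: "pos z = ereal r \<longleftrightarrow> z = ereal r \<and> 0 \<le> r"
  by (auto simp: pos_def)

lemma pos_mono: "y \<le> z \<Longrightarrow> pos y \<le> pos z"
  by (auto simp: pos_def)

context charging_instance
begin

definition valid_levels :: "ereal set" where
  "valid_levels = {0..ereal (capacity I)} \<union> {-\<infinity>}"

lemma valid_levels_cases:
  assumes "l \<in> valid_levels"
  obtains "l = -\<infinity>" | r where "l = ereal r" "r \<in> {0..capacity I}"
  using assms by (cases l) (auto simp: valid_levels_def)

lemma valid_levels_ereal [simp]: "ereal r \<in> valid_levels \<longleftrightarrow> r \<in> {0..capacity I}"
  by (auto simp: valid_levels_def)

lemma valid_levels_MInf [simp]: "-\<infinity> \<in> valid_levels"
  by (simp add: valid_levels_def)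

lemma pos_diff_valid:
  assumes "l \<in> valid_levels" "0 \<le> e"
  shows "pos (l - ereal e) \<in> valid_levels"
  using assms(1) by (cases rule: valid_levels_cases) (use assms(2) in \<open>auto simp: pos_def\<close>)

lemma ext_flow_valid:
  assumes "l \<in> valid_levels" "0 \<le> \<tau>"
  shows "ext_flow I l \<tau> \<in> valid_levels"
  using assms(1)
  by (cases rule: valid_levels_cases) (use flow_range assms(2) in \<open>auto simp: ext_flow_def\<close>)

section \<open>Monotonicity of the flow and minimal charging times\<close>

lemma flow_level_le:
  assumes "l \<in> {0..capacity I}" "l' \<in> {0..capacity I}" "l \<le> l'" "0 \<le> \<tau>"
  shows "flow I l \<tau> \<le> flow I l' \<tau>"
  using mono_onD[OF flow_mono_level[OF assms(4)] assms(1-3)] .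

lemma flow_time_le:
  assumes "l \<in> {0..capacity I}" "0 \<le> \<tau>" "\<tau> \<le> \<tau>'"
  shows "flow I l \<tau> \<le> flow I l \<tau>'"
  using mono_onD[OF flow_mono_time[OF assms(1)], of \<tau> \<tau>'] assms by auto

text \<open>The gain over a fixed duration is no smaller from a lower level, so consuming
  \<open>e\<close> before charging costs at most \<open>e\<close> afterwards. This carries the level
  comparison across a trip.\<close>

lemma flow_diff_le:
  assumes "l \<in> {0..capacity I}" "0 \<le> e" "e \<le> l" "0 \<le> \<tau>"
  shows "flow I l \<tau> - e \<le> flow I (l - e) \<tau>"
proof -
  have "flow I l \<tau> - l \<le> flow I (l - e) \<tau> - (l - e)"
    using monotone_onD[OF flow_gain_antimono[OF assms(4)], of "l - e" l] assms by simp
  then show ?thesis by simp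
qed

text \<open>Continuity of the flow makes the set of times attaining \<open>l'\<close> closed; it
  therefore contains its infimum, and \<open>LEAST\<close> denotes a genuine minimum.\<close>

lemma min_charge_time:
  assumes "0 \<le> l" "l \<le> l'" "l' \<le> capacity I"
  shows min_charge_time_nonneg: "0 \<le> min_charge_time I l l'"
    and flow_min_charge_time: "flow I l (min_charge_time I l l') = l'"
    and min_charge_time_least: "\<And>\<tau>. 0 \<le> \<tau> \<Longrightarrow> flow I l \<tau> = l' \<Longrightarrow> min_charge_time I l l' \<le> \<tau>"
proof -
  define A where "A = {\<tau> \<in> {0..}. flow I l \<tau> = l'}"
  have "A \<noteq> {}" using reachable[OF assms] by (auto simp: A_def)
  moreover have "bdd_below A" by (auto simp: A_def)
  moreover have "closed A"
    unfolding A_def using flow_continuous[of l] assms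
    by (intro continuous_closed_preimage_constant) auto
  ultimately have "Inf A \<in> A" and "\<And>\<tau>. \<tau> \<in> A \<Longrightarrow> Inf A \<le> \<tau>"
    by (auto intro: closed_contains_Inf cInf_lower)
  moreover from this have "min_charge_time I l l' = Inf A"
    unfolding min_charge_time_def by (intro Least_equality) (auto simp: A_def)
  ultimately show "0 \<le> min_charge_time I l l'" "flow I l (min_charge_time I l l') = l'"
    "\<And>\<tau>. 0 \<le> \<tau> \<Longrightarrow> flow I l \<tau> = l' \<Longrightarrow> min_charge_time I l l' \<le> \<tau>"
    by (auto simp: A_def)
qed

text \<open>Overshooting \<open>l'\<close> suffices as a bound: before the minimal time the level is
  at most \<open>l'\<close>, so a level of at least \<open>l'\<close> would attain it too
  early.\<close>

lemma min_charge_time_le: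
  assumes "0 \<le> l" "l \<le> l'" "l' \<le> capacity I" "0 \<le> \<tau>" "l' \<le> flow I l \<tau>"
  shows "min_charge_time I l l' \<le> \<tau>"
proof (rule ccontr)
  assume *: "\<not> min_charge_time I l l' \<le> \<tau>"
  then have "flow I l \<tau> \<le> l'"
    using flow_time_le[of l \<tau> "min_charge_time I l l'"] flow_min_charge_time[of l l'] assms by auto
  then show False using min_charge_time_least[of l l' \<tau>] assms * by simp
qed

lemma charge_time_nonneg:
  assumes "l \<in> valid_levels" "\<not> ereal e \<le> l" "e \<le> capacity I"
  shows "0 \<le> charge_time I l e"
  using assms(1) by (cases rule: valid_levels_cases)
    (use assms(2,3) min_charge_time_nonneg in \<open>auto simp: charge_time_def\<close>)

end

section \<open>Levels and times along a station sequence\<close>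

locale charged_sequence = charging_instance I for I :: "'w charging_data" +
  fixes u v :: 'w and k :: nat and s :: "nat \<Rightarrow> 'w" and x :: ereal
  assumes sequence: "station_sequence I u v k s"
    and k_pos: "1 \<le> k"
    and start_valid: "x \<in> valid_levels"
begin

abbreviation \<delta> where "\<delta> i \<equiv> travel_time I (s i) (s (Suc i))"
abbreviation e where "e i \<equiv> travel_energy I (s i) (s (Suc i))"
abbreviation arr where "arr \<equiv> arrive I k s"
abbreviation dep where "dep \<equiv> depart I s"
abbreviation lb where "lb \<equiv> level_begin I k s x"
abbreviation le where "le \<equiv> level_end I k s x"
abbreviation feasible where "feasible \<equiv> feasible_schedule I k s"
abbreviation lazy where "lazy \<equiv> lazy_schedule I k s x"

declare level_begin.simps(2) [simp del] level_end.simps(2) [simp del]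

lemma location: "i \<le> Suc k \<Longrightarrow> s i \<in> locations I"
proof -
  assume "i \<le> Suc k"
  then consider "i = 0" | "i \<in> {1..k}" | "i = Suc k" by force
  then show ?thesis
    using sequence by cases (auto simp: station_sequence_def locations_def)
qed

lemma travel_nonneg: "i \<le> k \<Longrightarrow> 0 \<le> \<delta> i" "i \<le> k \<Longrightarrow> 0 \<le> e i"
  by (simp_all add: travel_time_nonneg travel_energy_nonneg location)

lemma travel_energy_le: "i < k \<Longrightarrow> e i \<le> capacity I"
  using sequence by (auto simp: station_sequence_def dest!: bspec[of _ _ "Suc i"])

lemma final_energy_nonneg: "0 \<le> energy I (s (Suc k))"
  using sequence energy_nonneg energy_0[of v] by (auto simp: station_sequence_def)

lemma levels_valid:
  "i \<le> Suc k \<Longrightarrow> lb t i \<in> valid_levels \<and> le t i \<in> valid_levels"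
proof (induction i)
  case (Suc i)
  then have "lb t (Suc i) \<in> valid_levels"
    by (auto simp: level_begin.simps(2) intro!: pos_diff_valid travel_nonneg)
  moreover have "le t (Suc i) \<in> valid_levels"
  proof (cases "Suc i \<le> k")
    case True
    then show ?thesis using calculation
      by (auto simp: level_end.simps(2) intro!: ext_flow_valid)
  next
    case False
    then have "i = k" using Suc.prems by simp
    then show ?thesis using calculation
      by (auto simp: level_end.simps(2) intro!: pos_diff_valid final_energy_nonneg)
  qed
  ultimately show ?case by blast
qed (simp add: start_valid)

lemma lb_valid: "i \<le> Suc k \<Longrightarrow> lb t i \<in> valid_levels"
  using levels_valid by blast

lemma le_valid: "i \<le> Suc k \<Longrightarrow> le t i \<in> valid_levels"
  using levels_valid by blast

lemma lb_range: "lb t i = ereal l \<Longrightarrow> i \<le> Suc k \<Longrightarrow> l \<in> {0..capacity I}"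
  using lb_valid[of i t] by simp

lemma le_eq_flow:
  assumes "lb t i = ereal l" "i \<in> {1..k}" "arr t i \<le> dep t i"
  shows "le t i = ereal (flow I l (dep t i - arr t i))"
  using assms by (cases i) (simp_all add: level_end.simps(2) ext_flow_def)

text \<open>Charging never recovers from \<open>-\<infinity>\<close>, so finiteness of a level can
  be traced backwards along the sequence.\<close>

lemma le_ereal_imp_lb:
  assumes "le t i = ereal r" "i \<in> {1..k}"
  obtains l where "lb t i = ereal l"
proof -
  have "lb t i \<noteq> -\<infinity>"
    using assms by (cases i) (auto simp: level_end.simps(2) ext_flow_def split: if_splits)
  then show thesis using that lb_valid[of i t] assms by (auto elim: valid_levels_cases)
qed

lemma lb_SucD:
  assumes "lb t (Suc i) = ereal l"
  shows "le t i = ereal (l + e i)" "0 \<le> l"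
  using assms by (cases "le t i"; auto simp: level_begin.simps(2) pos_eq_ereal_iff)+

lemma feasible_arr: "feasible t \<Longrightarrow> i \<le> k \<Longrightarrow> arr t (Suc i) = dep t i + \<delta> i"
  by (auto simp: feasible_schedule_def dest!: bspec[of _ _ "Suc i"])

lemma feasible_dep: "feasible t \<Longrightarrow> i \<in> {1..k} \<Longrightarrow> arr t i \<le> dep t i"
  unfolding feasible_schedule_def by blast

lemma arr_last: "arr t (Suc k) = begin_time I (s (Suc k))"
  by (simp add: arrive_def)

text \<open>The arrival at \<open>v\<close> is prescribed, which leaves no freedom in the last
  departure.\<close>

lemma feasible_dep_last: "feasible t \<Longrightarrow> dep t k = begin_time I (s (Suc k)) - \<delta> k"
  using feasible_arr[of t k] by (simp add: arr_last)

section \<open>The lazy schedule and its dominance\<close>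

lemma arr_lazy: "i < k \<Longrightarrow> arr lazy (Suc i) = dep lazy i + \<delta> i"
  using arrive_lazy_schedule[of "Suc i" k] by simp

lemma dep_lazy:
  assumes "i \<in> {1..<k}"
  shows "dep lazy i = arr lazy i +
    (if ereal (e i) \<le> lb lazy i then 0 else charge_time I (lb lazy i) (e i))"
  using depart_lazy_schedule[of i k I s x] assms by auto

lemma dep_lazy_last: "dep lazy k = begin_time I (s (Suc k)) - \<delta> k"
  using depart_lazy_schedule[of k k] k_pos by simp

text \<open>Charging time is added only when the level is too low, where it is non-negative; from
  level \<open>-\<infinity>\<close> it is 0 by convention. Hence feasibility can fail only at
  station \<open>k\<close>.\<close>

lemma arr_le_dep_lazy: "i \<in> {1..<k} \<Longrightarrow> arr lazy i \<le> dep lazy i"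
  using charge_time_nonneg[of "lb lazy i" "e i"] lb_valid[of i] travel_energy_le[of i]
  by (auto simp: dep_lazy)

lemma feasible_lazy_iff: "feasible lazy \<longleftrightarrow> arr lazy k \<le> dep lazy k"
proof
  assume *: "arr lazy k \<le> dep lazy k"
  have "arr lazy i = dep lazy (i - 1) + travel_time I (s (i - 1)) (s i)" if "i \<in> {1..k+1}" for i
  proof (cases "i = Suc k")
    case True
    then show ?thesis by (simp add: arr_last dep_lazy_last)
  next
    case False
    then show ?thesis using that arr_lazy[of "i - 1"] by (cases i) auto
  qed
  moreover have "arr lazy i \<le> dep lazy i" if "i \<in> {1..k}" for i
    using arr_le_dep_lazy[of i] * that by (cases "i = k") auto
  ultimately show "feasible lazy" by (simp add: feasible_schedule_def)
qed (use feasible_dep k_pos in auto)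

text \<open>This is the invariant, proved by induction on the station. A finite level of
  \<open>t\<close> at one station forces a finite level at the previous one, so the induction
  hypothesis applies there.\<close>

lemma lazy_dominates:
  assumes "feasible t" "1 \<le> i" "i \<le> k" "lb t i = ereal l"
  shows "\<exists>l'. lb lazy i = ereal l' \<and> arr lazy i \<le> arr t i \<and> l \<le> flow I l' (arr t i - arr lazy i)"
  using assms(2-)
proof (induction i arbitrary: l rule: nat_induct_at_least)
  case base
  \<comment> \<open>No schedule entry precedes the first arrival, so the two schedules agree there
    and the lead is 0.\<close>
  have "lb lazy 1 = lb t 1" by (rule level_cong) simp
  moreover have "arr lazy 1 = arr t 1"
    using arr_lazy[of 0] feasible_arr[OF assms(1), of 0] k_pos by (simp add: depart_def)
  ultimately show ?case
    using base lb_range[of t 1 l] flow_0[of l] by auto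
next
  case (Suc i)
  then have i: "i \<in> {1..<k}" "i \<in> {1..k}" by auto
  note end_t = lb_SucD[OF Suc.prems(2)]
  obtain m where m: "lb t i = ereal m"
    using le_ereal_imp_lb[OF end_t(1) i(2)] .
  obtain m' where m': "lb lazy i = ereal m'" "arr lazy i \<le> arr t i"
      "m \<le> flow I m' (arr t i - arr lazy i)"
    using Suc.IH[OF _ m] i by auto
  have range: "m \<in> {0..capacity I}" "m' \<in> {0..capacity I}"
    using lb_range[OF m] lb_range[OF m'(1)] i by auto
  \<comment> \<open>The charging durations of \<open>t\<close> and \<open>lazy\<close> at this
    station are \<open>\<tau>\<close> and \<open>\<tau>'\<close>; \<open>d\<close> is the current
    lead and \<open>y\<close> the level with which \<open>lazy\<close> departs.\<close>
  define \<tau> where "\<tau> = dep t i - arr t i"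
  define d where "d = arr t i - arr lazy i"
  define \<tau>' where "\<tau>' = dep lazy i - arr lazy i"
  define y where "y = flow I m' \<tau>'"
  have nonneg: "0 \<le> \<tau>" "0 \<le> d" "0 \<le> \<tau>'"
    using feasible_dep[OF assms(1) i(2)] m'(2) arr_le_dep_lazy[OF i(1)]
    by (simp_all add: \<tau>_def d_def \<tau>'_def)
  have e: "0 \<le> e i" "e i \<le> capacity I"
    using travel_nonneg[of i] travel_energy_le[of i] i by auto
  \<comment> \<open>If \<open>lazy\<close> charged through its lead and then as long as
    \<open>t\<close> does, it would depart with at least the level of \<open>t\<close>.\<close>
  have "l + e i = flow I m \<tau>"
    using end_t(1) le_eq_flow[OF m i(2) feasible_dep[OF assms(1) i(2)]] by (simp add: \<tau>_def)
  also have "\<dots> \<le> flow I (flow I m' d) \<tau>"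
    using range m'(3) nonneg flow_range by (intro flow_level_le) (auto simp: d_def)
  also have "\<dots> = flow I m' (d + \<tau>)"
    using range nonneg by (simp add: flow_add)
  finally have l: "l + e i \<le> flow I m' (d + \<tau>)" .
  \<comment> \<open>The next lead will be \<open>d + \<tau> - \<tau>'\<close>. It is non-negative
    because \<open>\<tau>'\<close> is 0 or the minimal time to reach \<open>e i\<close>, a level
    that \<open>d + \<tau>\<close> suffices to reach since \<open>0 \<le> l\<close>.\<close>
  have lead: "\<tau>' \<le> d + \<tau> \<and> e i \<le> y"
  proof (cases "e i \<le> m'")
    case True
    then have "\<tau>' = 0" using dep_lazy[OF i(1)] m'(1) by (simp add: \<tau>'_def)
    then show ?thesis using True nonneg flow_0[OF range(2)] by (simp add: y_def)
  next
    case False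
    then have *: "\<tau>' = min_charge_time I m' (e i)"
      using dep_lazy[OF i(1)] m'(1) by (simp add: \<tau>'_def charge_time_def)
    have "\<tau>' \<le> d + \<tau>"
      unfolding * using False range e nonneg l end_t(2) by (intro min_charge_time_le) auto
    moreover have "y = e i"
      unfolding y_def * using False range e by (intro flow_min_charge_time) auto
    ultimately show ?thesis by simp
  qed
  have y: "y \<in> {0..capacity I}"
    unfolding y_def by (rule flow_range[OF range(2) nonneg(3)])
  have "le lazy i = ereal y"
    using le_eq_flow[OF m'(1) i(2) arr_le_dep_lazy[OF i(1)]] by (simp add: y_def \<tau>'_def)
  then have "lb lazy (Suc i) = ereal (y - e i)"
    using lead by (simp add: level_begin.simps(2) pos_def)
  moreover have "arr t (Suc i) - arr lazy (Suc i) = d + \<tau> - \<tau>'"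
    using feasible_arr[OF assms(1), of i] arr_lazy[of i] i by (simp add: d_def \<tau>_def \<tau>'_def)
  moreover have "l \<le> flow I (y - e i) (d + \<tau> - \<tau>')"
  proof -
    \<comment> \<open>Charging for \<open>d + \<tau>\<close> is split at the lazy departure;
      \<open>flow_diff_le\<close> then moves the trip's consumption ahead of the remaining
      charging.\<close>
    have "flow I m' (d + \<tau>) = flow I y (d + \<tau> - \<tau>')"
      unfolding y_def using flow_add[OF range(2) nonneg(3), of "d + \<tau> - \<tau>'"] lead by simp
    then show ?thesis
      using l flow_diff_le[OF y e(1), of "d + \<tau> - \<tau>'"] lead by simp
  qed
  ultimately show ?case using lead by auto
qed

section \<open>From dominance to optimality\<close>

lemma final_level_lazy:
  assumes t: "feasible t" and "final_level I k s x t \<noteq> -\<infinity>"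
  shows "arr lazy k \<le> dep lazy k" "final_level I k s x t \<le> final_level I k s x lazy"
proof -
  have k: "k \<in> {1..k}" using k_pos by simp
  \<comment> \<open>The final level is a monotone function of the level on leaving station
    \<open>k\<close>, so only the latter needs comparing.\<close>
  have final: "final_level I k s x t' =
      pos (pos (le t' k - ereal (e k)) - ereal (energy I (s (Suc k))))"
    for t' by (simp add: final_level_def level_end.simps(2) level_begin.simps(2))
  have "le t k \<noteq> -\<infinity>"
    using assms(2) by (auto simp: final pos_def)
  then obtain r where "le t k = ereal r"
    using le_valid[of k t] by (auto elim: valid_levels_cases)
  then obtain l where l: "lb t k = ereal l"
    using le_ereal_imp_lb k by blast
  obtain l' where l': "lb lazy k = ereal l'" "arr lazy k \<le> arr t k"
      "l \<le> flow I l' (arr t k - arr lazy k)"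
    using lazy_dominates[OF t k_pos _ l] by auto
  have range: "l \<in> {0..capacity I}" "l' \<in> {0..capacity I}"
    using lb_range[OF l] lb_range[OF l'(1)] by auto
  have dep: "dep t k = dep lazy k"
    by (simp add: feasible_dep_last[OF t] dep_lazy_last)
  have arr: "arr t k \<le> dep t k" by (rule feasible_dep[OF t k])
  then show *: "arr lazy k \<le> dep lazy k"
    using l'(2) dep by simp
  \<comment> \<open>With a common departure, the lead and the stay of \<open>t\<close> add up to the
    stay of \<open>lazy\<close>.\<close>
  have "flow I l (dep t k - arr t k) \<le> flow I (flow I l' (arr t k - arr lazy k)) (dep t k - arr t k)"
    using range l' arr flow_range by (intro flow_level_le) auto
  also have "\<dots> = flow I l' (dep lazy k - arr lazy k)"
    using flow_add[OF range(2), of "arr t k - arr lazy k" "dep t k - arr t k"] l'(2) arr dep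
    by simp
  finally have "le t k \<le> le lazy k"
    using le_eq_flow[OF l k arr] le_eq_flow[OF l'(1) k *] by simp
  then show "final_level I k s x t \<le> final_level I k s x lazy"
    unfolding final by (intro pos_mono ereal_minus_mono) auto
qed

text \<open>The maximum must range over a nonempty set for \<open>GREATEST\<close> to have a value,
  also when \<open>lazy\<close> is infeasible.\<close>

lemma feasible_exists: "\<exists>t. feasible t"
proof -
  \<comment> \<open>\<open>T i\<close> is the arrival time when travelling without stops. All slack
    is spent at station \<open>k\<close>; it is non-negative by the time condition of the station
    sequence.\<close>
  define T where "T i = end_time I (s 0) + (\<Sum>j<i. \<delta> j)" for i
  define t where "t i = (T i, if i = k then begin_time I (s (Suc k)) - \<delta> k else T i)" for i
  have sum: "(\<Sum>i=1..k+1. travel_time I (s (i - 1)) (s i)) = (\<Sum>j<Suc k. \<delta> j)"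
    by (rule sum.reindex_bij_witness[of _ Suc "\<lambda>i. i - 1"]) auto
  have "T k \<le> begin_time I (s (Suc k)) - \<delta> k"
    using sequence unfolding station_sequence_def sum by (auto simp: T_def)
  then have "feasible t"
    using k_pos unfolding feasible_schedule_def
  proof (intro conjI ballI)
    fix i assume "i \<in> {1..k+1}"
    then obtain j where "i = Suc j" "j \<le> k" by (cases i) auto
    then show "arr t i = dep t (i - 1) + travel_time I (s (i - 1)) (s i)"
      using k_pos by (auto simp: arrive_def depart_def t_def T_def)
  qed (auto simp: arrive_def depart_def t_def)
  then show ?thesis by blast
qed

lemma best_level_eqI:
  assumes "feasible t" "\<And>t'. feasible t' \<Longrightarrow> final_level I k s x t' \<le> final_level I k s x t"
  shows "best_level I k s x = final_level I k s x t"
  unfolding best_level_def using assms by (intro Greatest_equality) auto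

lemma lazy_optimal:
  assumes "feasible lazy"
  shows "optimal_schedule I k s x lazy" "best_level I k s x = final_level I k s x lazy"
proof -
  have *: "final_level I k s x t \<le> final_level I k s x lazy" if "feasible t" for t
    using final_level_lazy(2)[OF that] by (cases "final_level I k s x t = -\<infinity>") auto
  then show "optimal_schedule I k s x lazy"
    using assms by (auto simp: optimal_schedule_def is_arg_max_def not_less)
  show "best_level I k s x = final_level I k s x lazy"
    using assms * by (rule best_level_eqI)
qed

text \<open>A feasible schedule with finite final level would make the lazy one feasible, so every
  feasible schedule ends at \<open>-\<infinity>\<close>.\<close>

lemma lazy_infeasible:
  assumes "\<not> feasible lazy"
  shows "best_level I k s x = -\<infinity>"
proof -
  have *: "final_level I k s x t = -\<infinity>" if "feasible t" for t
    using final_level_lazy(1)[OF that] assms feasible_lazy_iff by blast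
  obtain t where "feasible t" using feasible_exists by blast
  then show ?thesis using best_level_eqI[of t] * by simp
qed

end

theorem theorem1:
  fixes I :: "'w charging_data" and u v :: 'w and k :: nat and s :: "nat \<Rightarrow> 'w" and x :: ereal
  assumes "charging_instance I"
    and "station_sequence I u v k s" and "1 \<le> k"
    and "x \<in> {0..ereal (capacity I)} \<union> {-\<infinity>}"
  shows "let t = lazy_schedule I k s x in
    (feasible_schedule I k s t \<longleftrightarrow> arrive I k s t k \<le> depart I s t k) \<and>
    (feasible_schedule I k s t \<longrightarrow>
      optimal_schedule I k s x t \<and> best_level I k s x = final_level I k s x t) \<and>
    (\<not> feasible_schedule I k s t \<longrightarrow> best_level I k s x = -\<infinity>)"
proof -
  interpret charging_instance I by fact
  interpret charged_sequence I u v k s x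
    by unfold_locales (use assms in \<open>auto simp: valid_levels_def\<close>)
  show ?thesis
    unfolding Let_def using feasible_lazy_iff lazy_optimal lazy_infeasible by blast
qed

end
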